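(* A valid core inequality $\beta_0+\sum_{j=1}^n\beta_jx_j+\beta' y\ge 0$ with $\beta_1=\cdots=\beta_n$ is a core facet if and only if it is satisfied exactly at $(x^k,m(x^k))$ for at least two of the extreme points $x^k$, $k\in\{0,\dots,n\}$, of the simplex $\mathcal{S}$, with at least one of these extreme points not being $x^0$ or $x^n$.
   Context: Let $n\ge 2$, $N=\{1,\dots,n\}$, and let $\ell<u$ be real numbers. Let $X=\{x\in\mathbb{R}^n:\ell\le x_j\le u,\ j\in N\}$. For real coefficients $c_2,\dots,c_n$, not all zero, let $m(x)=\sum_{i=2}^n c_i\sum_{J\subseteq N,\ |J|=i}\prod_{j\in J}x_j$, and let $G=\{(x,y)\in\mathbb{R}^n\times\mathbb{R}: x\in X,\ y=m(x)\}$. The set $\operatorname{conv}(G)$ is a polytope of dimension $n+1$. Let $\mathcal{S}=\{x\in\mathbb{R}^n:u\ge x_1\ge\cdots\ge x_n\ge\ell\}$, whose extreme points are $x^k$, $k=0,\dots,n$, where $x^k$ has its first $k$ entries equal to $u$ and its last $n-k$ entries equal to $\ell$. A core inequality is a linear inequality $\beta_0+\sum_{j=1}^n\beta_jx_j+\beta' y\ge 0$ with $\beta'\in\{-1,1\}$ and $\beta_1\le\cdots\le\beta_n$; it is a valid core inequality if it is satisfied by all points of $\operatorname{conv}(G)$; it is a core facet if it is valid and the set of points of $\operatorname{conv}(G)$ satisfying it with equality is a facet of $\operatorname{conv}(G)$. "Satisfied exactly" means satisfied with equality. *)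

theory Defs
  imports "HOL-Analysis.Analysis"
begin

text \<open>
  The index set \<open>N = {1, \<dots>, n}\<close> is a finite linearly ordered type \<open>'n\<close> with \<open>n = CARD('n)\<close>;
  an index \<open>j\<close> stands for the number \<open>card {..j}\<close>.  Every such type is order isomorphic to
  \<open>{1, \<dots>, n}\<close>.  Only \<open>c 2, \<dots>, c n\<close> of a coefficient sequence \<open>c\<close> are used.
\<close>

definition box_X :: "real \<Rightarrow> real \<Rightarrow> (real ^ 'n::{finite,linorder}) set" where
  "box_X l u = {x. \<forall>j. l \<le> x $ j \<and> x $ j \<le> u}"

definition sym_multilin :: "(nat \<Rightarrow> real) \<Rightarrow> real ^ 'n::{finite,linorder} \<Rightarrow> real" where
  "sym_multilin c x =
     (\<Sum>i = 2..CARD('n). c i * (\<Sum>J \<in> {J :: 'n set. card J = i}. \<Prod>j\<in>J. x $ j))"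

definition graph_G ::
  "(nat \<Rightarrow> real) \<Rightarrow> real \<Rightarrow> real \<Rightarrow> ((real ^ 'n::{finite,linorder}) \<times> real) set" where
  "graph_G c l u = {(x, y). x \<in> box_X l u \<and> y = sym_multilin c x}"

definition simplex_S :: "real \<Rightarrow> real \<Rightarrow> (real ^ 'n::{finite,linorder}) set" where
  "simplex_S l u = {x. (\<forall>j. l \<le> x $ j \<and> x $ j \<le> u) \<and> (\<forall>i j. i \<le> j \<longrightarrow> x $ j \<le> x $ i)}"

definition simplex_pt :: "real \<Rightarrow> real \<Rightarrow> nat \<Rightarrow> real ^ 'n::{finite,linorder}" where
  "simplex_pt l u k = (\<chi> j. if card {..j} \<le> k then u else l)"

text \<open>
  A linear inequality \<open>b\<^sub>0 + (\<Sum>j. b $ j * x $ j) + b' * y \<ge> 0\<close> is represented by its coefficients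
  \<open>(b\<^sub>0, b, b')\<close>.
\<close>

definition ineq_lhs ::
  "real \<Rightarrow> real ^ 'n::{finite,linorder} \<Rightarrow> real \<Rightarrow> (real ^ 'n::{finite,linorder}) \<times> real \<Rightarrow> real" where
  "ineq_lhs b\<^sub>0 b b' p = b\<^sub>0 + (\<Sum>j\<in>UNIV. b $ j * fst p $ j) + b' * snd p"

definition core_ineq :: "real \<Rightarrow> real ^ 'n::{finite,linorder} \<Rightarrow> real \<Rightarrow> bool" where
  "core_ineq b\<^sub>0 b b' \<longleftrightarrow> b' \<in> {-1, 1} \<and> (\<forall>i j. i \<le> j \<longrightarrow> b $ i \<le> b $ j)"

definition valid_core_ineq ::
  "(nat \<Rightarrow> real) \<Rightarrow> real \<Rightarrow> real \<Rightarrow> real \<Rightarrow> real ^ 'n::{finite,linorder} \<Rightarrow> real \<Rightarrow> bool" where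
  "valid_core_ineq c l u b\<^sub>0 b b' \<longleftrightarrow>
     core_ineq b\<^sub>0 b b' \<and> (\<forall>p \<in> convex hull (graph_G c l u). ineq_lhs b\<^sub>0 b b' p \<ge> 0)"

definition core_facet ::
  "(nat \<Rightarrow> real) \<Rightarrow> real \<Rightarrow> real \<Rightarrow> real \<Rightarrow> real ^ 'n::{finite,linorder} \<Rightarrow> real \<Rightarrow> bool" where
  "core_facet c l u b\<^sub>0 b b' \<longleftrightarrow>
     valid_core_ineq c l u b\<^sub>0 b b' \<and>
     {p \<in> convex hull (graph_G c l u). ineq_lhs b\<^sub>0 b b' p = 0}
       facet_of (convex hull (graph_G c l u))"

definition exact_at ::
  "(nat \<Rightarrow> real) \<Rightarrow> real \<Rightarrow> real ^ 'n::{finite,linorder} \<Rightarrow> real \<Rightarrow> real ^ 'n::{finite,linorder} \<Rightarrow> bool" where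
  "exact_at c b\<^sub>0 b b' x \<longleftrightarrow> ineq_lhs b\<^sub>0 b b' (x, sym_multilin c x) = 0"

lemma card_atMost_image:
  "(\<lambda>j::'n::{finite,linorder}. card {..j}) ` UNIV = {1..CARD('n)}"
proof -
  have inj: "inj (\<lambda>j::'n. card {..j})"
    by (metis (mono_tags, lifting) atMost_subset_iff card_subset_eq finite injI linorder_linear 
        atMost_eq_iff)
  have "card {..j} \<in> {1..CARD('n)}" for j :: 'n
    using card_gt_0_iff[of "{..j}"] card_mono[of UNIV "{..j}"] by (auto simp: Suc_le_eq)
  then have "(\<lambda>j::'n. card {..j}) ` UNIV \<subseteq> {1..CARD('n)}" by blast
  then show ?thesis
    by (intro card_subset_eq) (simp_all add: card_image[OF inj])
qed

lemma inj_on_simplex_pt: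
  assumes "l < u"
  shows "inj_on (simplex_pt l u :: nat \<Rightarrow> real ^ 'n::{finite,linorder}) {0..CARD('n)}"
proof (rule linorder_inj_onI)
  fix h k :: nat
  assume hk: "h < k" "h \<in> {0..CARD('n)}" "k \<in> {0..CARD('n)}"
  then have "k \<in> range (\<lambda>j::'n. card {..j})"
    by (simp add: card_atMost_image)
  then obtain j :: 'n where "card {..j} = k"
    by auto
  then have "simplex_pt l u h $ j \<noteq> (simplex_pt l u k :: real ^ 'n::{finite,linorder}) $ j"
    using hk assms by (simp add: simplex_pt_def)
  then show "simplex_pt l u h \<noteq> (simplex_pt l u k :: real ^ 'n::{finite,linorder})" by metis
qed auto

lemma extreme_points_simplex_S:
  assumes lu: "l < u"
  shows "{x. x extreme_point_of (simplex_S l u :: (real ^ 'n::{finite,linorder}) set)}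
           = simplex_pt l u ` {0..CARD('n)}"
proof (intro set_eqI iffI)
  fix x :: "real ^ 'n::{finite,linorder}"
  assume "x \<in> {x. x extreme_point_of simplex_S l u}"
  then have xS: "x \<in> simplex_S l u"
    and ext: "\<And>a b. a \<in> simplex_S l u \<Longrightarrow> b \<in> simplex_S l u \<Longrightarrow> x \<notin> open_segment a b"
    by (auto simp: extreme_point_of_def)
  have bd: "l \<le> x $ j" "x $ j \<le> u" for j using xS by (auto simp: simplex_S_def)
  have anti: "i \<le> j \<Longrightarrow> x $ j \<le> x $ i" for i j using xS by (auto simp: simplex_S_def)
  have lu_val: "x $ j = l \<or> x $ j = u" for j
  proof (rule ccontr)
    assume nb: "\<not> (x $ j = l \<or> x $ j = u)"
    define a where "a = x $ j"
    define D where "D = (\<lambda>i. \<bar>x $ i - a\<bar>) ` {i. x $ i \<noteq> a} \<union> {a - l, u - a}"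
    define e where "e = Min D"
    have fin: "finite D" "D \<noteq> {}" by (auto simp: D_def)
    have "\<forall>d\<in>D. d > 0" using nb bd[of j] by (auto simp: D_def a_def)
    then have e: "e > 0" using fin by (simp add: e_def)
    have eD: "d \<in> D \<Longrightarrow> e \<le> d" for d using fin by (simp add: e_def)
    have e1: "x $ i \<noteq> a \<Longrightarrow> e \<le> \<bar>x $ i - a\<bar>" for i by (rule eD) (auto simp: D_def)
    have e2: "e \<le> a - l" "e \<le> u - a" by (auto intro!: eD simp: D_def)
    define w where "w s = (\<chi> i. if x $ i = a then a + s else x $ i)" for s
    have wS: "w s \<in> simplex_S l u" if s: "\<bar>s\<bar> \<le> e" for s
    proof -
      have "l \<le> w s $ i \<and> w s $ i \<le> u" for i using s e2 bd[of i] by (auto simp: w_def)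
      moreover have "w s $ k \<le> w s $ i" if "i \<le> k" for i k
        using s anti[OF that] e1[of i] e1[of k] by (auto simp: w_def)
      ultimately show ?thesis by (simp add: simplex_S_def)
    qed
    have "w e $ j \<noteq> w (-e) $ j" using e by (simp add: w_def a_def)
    then have ne: "w e \<noteq> w (-e)" by metis
    have mid: "x = midpoint (w e) (w (-e))"
      by (simp add: vec_eq_iff midpoint_def w_def)
    have "x \<in> open_segment (w e) (w (-e))" using ne mid by simp
    then show False using ext[OF wS wS, of e "-e"] e by simp
  qed
  define A where "A = {j. x $ j = u}"
  define k where "k = card A"
  have down: "i \<in> A" if "i \<le> j" "j \<in> A" for i j
    using that anti[of i j] bd[of i] by (auto simp: A_def)
  have "j \<in> A \<longleftrightarrow> card {..j} \<le> k" for j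
  proof
    assume "j \<in> A"
    then have "{..j} \<subseteq> A" using down by blast
    then show "card {..j} \<le> k" by (simp add: k_def card_mono)
  next
    assume le: "card {..j} \<le> k"
    show "j \<in> A"
    proof (rule ccontr)
      assume j: "j \<notin> A"
      have "A \<subset> {..j}" using j down by (metis atMost_iff linorder_linear order_refl psubsetI subsetI)
      then have "card A < card {..j}" by (simp add: psubset_card_mono)
      then show False using le by (simp add: k_def)
    qed
  qed
  then have "x = simplex_pt l u k"
    using lu_val by (auto simp: vec_eq_iff simplex_pt_def A_def)
  moreover have "k \<in> {0..CARD('n)}" by (simp add: k_def card_mono)
  ultimately show "x \<in> simplex_pt l u ` {0..CARD('n)}" by blast
next
  fix x :: "real ^ 'n::{finite,linorder}"
  assume "x \<in> simplex_pt l u ` {0..CARD('n)}"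
  then obtain k where x: "x = simplex_pt l u k" by blast
  have "card {..i} \<le> card {..j}" if "i \<le> j" for i j :: 'n
    using that by (simp add: card_mono)
  then have xS: "x \<in> simplex_S l u"
    using lu by (fastforce simp: x simplex_S_def simplex_pt_def)
  have "x \<notin> open_segment a b" if a: "a \<in> simplex_S l u" and b: "b \<in> simplex_S l u" for a b
  proof
    assume "x \<in> open_segment a b"
    then obtain t where t: "a \<noteq> b" "0 < t" "t < 1" "x = (1 - t) *\<^sub>R a + t *\<^sub>R b"
      by (auto simp: in_segment)
    have "a $ j = b $ j" for j
    proof -
      have ab: "l \<le> a $ j" "a $ j \<le> u" "l \<le> b $ j" "b $ j \<le> u"
        using a b by (auto simp: simplex_S_def)
      have xj: "x $ j = (1 - t) * a $ j + t * b $ j" using t(4) by simp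
      have "x $ j = l \<or> x $ j = u" by (simp add: x simplex_pt_def)
      then show ?thesis
      proof
        assume "x $ j = l"
        then have "(1 - t) * (a $ j - l) + t * (b $ j - l) = 0"
          using xj by (simp add: algebra_simps)
        then show ?thesis using t(2,3) ab
          by (simp add: add_nonneg_eq_0_iff)
      next
        assume "x $ j = u"
        then have "(1 - t) * (u - a $ j) + t * (u - b $ j) = 0"
          using xj by (simp add: algebra_simps)
        then show ?thesis using t(2,3) ab
          by (simp add: add_nonneg_eq_0_iff)
      qed
    qed
    then show False using t(1) by (simp add: vec_eq_iff)
  qed
  then show "x \<in> {x. x extreme_point_of simplex_S l u}"
    using xS by (simp add: extreme_point_of_def)
qed

end

theory Submission
  imports Defs
begin

text \<open>
  The polynomial \<open>sym_multilin c\<close> is affine in each coordinate separately.  Hence every point of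
  its graph over the box is obtained from the graph points over the \<open>2\<^sup>n\<close> box vertices by
  successive convex combinations, and \<open>convex hull (graph_G c l u)\<close> is the convex hull of
  these lifted vertices (\<open>convex_hull_graph_G\<close>).  A valid inequality cuts out a face, which is
  therefore the convex hull of the lifted vertices at which the inequality is tight.  As the
  coefficient of \<open>y\<close> does not vanish, the tight points project injectively to the \<open>x\<close>-space,
  so the inequality defines a facet iff the tight vertices of the box affinely span
  \<open>\<real>\<^sup>n\<close> (\<open>core_facet_iff_tight_vertices\<close>).  This uses that the hull has full dimension
  \<open>n + 1\<close>, which holds because \<open>sym_multilin c\<close> is not affine on the box
  (\<open>aff_dim_convex_hull_graph_G\<close>).

  If all coefficients of \<open>x\<close> are equal, the left-hand side at a vertex depends only on the number
  of coordinates equal to \<open>u\<close>.  The set of tight vertices is then a union of layers, a layer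
  being the set of vertices with a given number of coordinates equal to \<open>u\<close>.  It remains to
  decide when a union of layers spans affinely (\<open>aff_dim_layers\<close>).  A single layer lies on a
  hyperplane where the coordinate sum is constant; the layers \<open>0\<close> and \<open>n\<close> are single
  points on the diagonal, which for \<open>n \<ge> 2\<close> lies in a hyperplane.  Conversely, exchanging two
  coordinates inside a layer \<open>0 < k < n\<close> shows that a hyperplane containing it has
  a constant coordinate sum, and no second layer has the same sum.
\<close>

section \<open>Box vertices and layers\<close>

definition box_vertex :: "real \<Rightarrow> real \<Rightarrow> 'n set \<Rightarrow> real ^ 'n::finite" where
  "box_vertex l u K = (\<chi> j. if j \<in> K then u else l)"

lemma box_vertex_nth [simp]: "box_vertex l u K $ j = (if j \<in> K then u else l)"
  by (simp add: box_vertex_def)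

lemma simplex_pt_eq_box_vertex:
  "(simplex_pt l u k :: real ^ 'n::{finite,linorder}) = box_vertex l u {j. card {..j} \<le> k}"
  by (simp add: vec_eq_iff simplex_pt_def)

lemma card_initial_segment:
  assumes "k \<le> CARD('n::{finite,linorder})"
  shows "card {j :: 'n. card {..j} \<le> k} = k"
proof -
  let ?r = "\<lambda>j :: 'n. card {..j}"
  have inj: "inj ?r"
    by (rule eq_card_imp_inj_on) (simp_all add: card_atMost_image)
  have "?r ` {j. ?r j \<le> k} = {i \<in> range ?r. i \<le> k}"
    by blast
  also have "\<dots> = {1..k}"
    using assms by (auto simp: card_atMost_image)
  finally have "card (?r ` {j. ?r j \<le> k}) = k"
    by simp
  then show ?thesis
    by (simp add: card_image inj_on_subset[OF inj])
qed

lemma aff_dim_eq_DIM_iff: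
  fixes S :: "'a::euclidean_space set"
  shows "aff_dim S = DIM('a) \<longleftrightarrow> (\<forall>a d. S \<subseteq> {x. a \<bullet> x = d} \<longrightarrow> a = 0)"
proof
  assume full: "aff_dim S = DIM('a)"
  show "\<forall>a d. S \<subseteq> {x. a \<bullet> x = d} \<longrightarrow> a = 0"
  proof (intro allI impI, rule ccontr)
    fix a :: 'a and d
    assume "S \<subseteq> {x. a \<bullet> x = d}" "a \<noteq> 0"
    then have "aff_dim S \<le> DIM('a) - 1"
      by (metis aff_dim_subset aff_dim_hyperplane)
    then show False
      using full DIM_positive[where 'a = 'a] by linarith
  qed
next
  assume "\<forall>a d. S \<subseteq> {x. a \<bullet> x = d} \<longrightarrow> a = 0"
  then have "\<not> aff_dim S < DIM('a)"
    by (metis aff_lowdim_subset_hyperplane)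
  then show "aff_dim S = DIM('a)"
    using aff_dim_le_DIM[of S] by linarith
qed

lemma sum_box_vertex:
  "(\<Sum>j\<in>UNIV. box_vertex l u K $ j) = real (CARD('n)) * l + real (card K) * (u - l)"
  for K :: "'n::finite set"
proof -
  have "(\<Sum>j\<in>UNIV. box_vertex l u K $ j) = (\<Sum>j\<in>UNIV. l + (if j \<in> K then u - l else 0))"
    by (rule sum.cong) auto
  also have "\<dots> = real (CARD('n)) * l + real (card K) * (u - l)"
    by (simp add: sum.distrib flip: sum.inter_filter)
  finally show ?thesis .
qed

text \<open>
  Replacing \<open>i\<close> by \<open>j\<close> in a \<open>k\<close>-set changes the inner product of \<open>a\<close> with the vertex by
  \<open>(u - l) * (a $ j - a $ i)\<close>, which has to vanish if the whole layer lies in the hyperplane.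
  The bounds on \<open>k\<close> guarantee a \<open>k\<close>-set that contains \<open>i\<close> but not \<open>j\<close>.
\<close>

lemma hyperplane_through_layer:
  fixes a :: "real ^ 'n::finite"
  assumes lu: "l < u" and k: "0 < k" "k < CARD('n)"
    and hyp: "\<And>K. card K = k \<Longrightarrow> a \<bullet> box_vertex l u K = d"
  shows "a $ i = a $ j"
proof (cases "i = j")
  case False
  have "k - 1 \<le> card (UNIV - {i, j})"
    using k False by (simp add: card_Diff_subset)
  then obtain M where M: "M \<subseteq> UNIV - {i, j}" "card M = k - 1"
    by (meson obtain_subset_with_card_n)
  have "i \<notin> M" "j \<notin> M"
    using M by auto
  then have card: "card (insert i M) = k" "card (insert j M) = k"
    using k M by simp_all
  have "a \<bullet> box_vertex l u (insert m M) = a \<bullet> box_vertex l u M + (u - l) * a $ m"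
    if "m \<notin> M" for m
  proof -
    have "box_vertex l u (insert m M) = box_vertex l u M + (u - l) *\<^sub>R axis m 1"
      using that by (auto simp: vec_eq_iff axis_def)
    then show ?thesis
      by (simp add: inner_add_right inner_axis)
  qed
  then have "(u - l) * a $ i = (u - l) * a $ j"
    using hyp[OF card(1)] hyp[OF card(2)] \<open>i \<notin> M\<close> \<open>j \<notin> M\<close> by fastforce
  then show ?thesis
    using lu by simp
qed simp

lemma aff_dim_layers:
  assumes n: "CARD('n::finite) \<ge> 2" and lu: "l < u"
  shows "aff_dim (box_vertex l u ` {K :: 'n set. card K \<in> R}) = CARD('n) \<longleftrightarrow>
    (\<exists>k \<in> {0..CARD('n)}. \<exists>k' \<in> {0..CARD('n)}. k \<noteq> k' \<and> k \<notin> {0, CARD('n)} \<and> k \<in> R \<and> k' \<in> R)"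
    (is "aff_dim ?V = _ \<longleftrightarrow> ?two")
proof -
  have "(\<forall>a d. ?V \<subseteq> {x. a \<bullet> x = d} \<longrightarrow> a = 0) \<longleftrightarrow> ?two"
  proof
    assume spans: "\<forall>a d. ?V \<subseteq> {x. a \<bullet> x = d} \<longrightarrow> a = 0"
    show ?two
    proof (rule ccontr)
      assume none: "\<not> ?two"
      show False
      proof (cases "\<exists>k \<in> R. 0 < k \<and> k < CARD('n)")
        case True
        then obtain k where k: "k \<in> R" "0 < k" "k < CARD('n)"
          by blast
        have single: "card K = k" if "card K \<in> R" for K :: "'n set"
        proof -
          have "card K \<le> CARD('n)"
            by (simp add: card_mono)
          then show ?thesis
            using none k that by force
        qed
        \<comment> \<open>A single layer lies on a hyperplane of constant coordinate sum.\<close>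
        define a :: "real ^ 'n" where "a = vec 1"
        have "a \<bullet> x = (\<Sum>j\<in>UNIV. x $ j)" for x
          by (simp add: a_def inner_vec_def)
        then have "?V \<subseteq> {x. a \<bullet> x = real (CARD('n)) * l + real k * (u - l)}"
          using single by (auto simp: sum_box_vertex simp del: box_vertex_nth)
        then have "a = 0"
          using spans by blast
        then show False
          by (simp add: a_def vec_eq_iff)
      next
        case False
        obtain i j :: 'n where ij: "i \<noteq> j"
          using n card_le_Suc0_iff_eq[of "UNIV :: 'n set"] by auto
        have ends: "K = {} \<or> K = UNIV" if "card K \<in> R" for K :: "'n set"
        proof -
          have "\<not> (0 < card K \<and> card K < CARD('n))"
            using False that by blast
          then have "card K = 0 \<or> card K = card (UNIV :: 'n set)"
            using card_mono[OF finite subset_UNIV, of K] by linarith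
          then show ?thesis
            using card_subset_eq[OF finite subset_UNIV, of K] by auto
        qed
        \<comment> \<open>Both extreme layers lie on the diagonal, hence on the hyperplane \<open>x $ i = x $ j\<close>.\<close>
        define a :: "real ^ 'n" where "a = axis i 1 - axis j 1"
        have "a \<bullet> x = x $ i - x $ j" for x
          by (simp add: a_def inner_diff_left inner_axis')
        then have "?V \<subseteq> {x. a \<bullet> x = 0}"
          by (auto dest!: ends)
        then have "a = 0"
          using spans by blast
        then have "a $ i = 0"
          by simp
        then show False
          using ij by (simp add: a_def axis_def)
      qed
    qed
  next
    assume ?two
    then obtain k k' where k: "0 < k" "k < CARD('n)" "k \<in> R"
      and k': "k' \<le> CARD('n)" "k' \<in> R" "k \<noteq> k'"
      by auto
    show "\<forall>a d. ?V \<subseteq> {x. a \<bullet> x = d} \<longrightarrow> a = 0"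
    proof (intro allI impI)
      fix a :: "real ^ 'n" and d
      assume "?V \<subseteq> {x. a \<bullet> x = d}"
      then have hyp: "a \<bullet> box_vertex l u K = d" if "card K \<in> R" for K
        using that by blast
      obtain s where s: "\<And>j. a $ j = s"
        using hyperplane_through_layer[OF lu k(1,2), of a d] hyp k(3) by metis
      have val: "a \<bullet> box_vertex l u K = s * (real (CARD('n)) * l + real (card K) * (u - l))" for K
        by (simp add: inner_vec_def s sum_distrib_left[symmetric] sum_box_vertex del: box_vertex_nth)
      obtain K K' :: "'n set" where "card K = k" "card K' = k'"
        using k k' by (metis less_imp_le obtain_subset_with_card_n)
      then have "s * (real k * (u - l)) = s * (real k' * (u - l))"
        using hyp[of K] hyp[of K'] k(3) k'(2) by (simp add: val algebra_simps)
      then have "s = 0"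
        using lu k'(3) by simp
      then show "a = 0"
        by (simp add: vec_eq_iff s)
    qed
  qed
  then show ?thesis
    using aff_dim_eq_DIM_iff[of ?V] by simp
qed

section \<open>The convex hull of the graph\<close>

text \<open>
  The polynomial is affine in \<open>x $ j\<close> when the other coordinates are fixed, so a graph point
  lies on the segment between the two graph points with \<open>x $ j\<close> replaced by \<open>l\<close> and by \<open>u\<close>.
\<close>

lemma convex_hull_graph_G:
  fixes c :: "nat \<Rightarrow> real"
  assumes lu: "l < u"
  shows "convex hull (graph_G c l u :: ((real ^ 'n::{finite,linorder}) \<times> real) set) =
    convex hull (range (\<lambda>K. (box_vertex l u K, sym_multilin c (box_vertex l u K))))"
    (is "_ = convex hull ?W")
proof (rule antisym)
  define upd where "upd x j s = (\<chi> i. if i = j then s else x $ i)"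
    for x :: "real ^ 'n::{finite,linorder}" and j s
  have affine: "sym_multilin c (upd x j ((1 - t) * s + t * s')) =
      (1 - t) * sym_multilin c (upd x j s) + t * sym_multilin c (upd x j s')" for x j t s s'
  proof -
    have prods: "(\<Prod>i\<in>J. upd x j ((1 - t) * s + t * s') $ i) =
        (1 - t) * (\<Prod>i\<in>J. upd x j s $ i) + t * (\<Prod>i\<in>J. upd x j s' $ i)" for J
    proof (cases "j \<in> J")
      case True
      have "(\<Prod>i\<in>J. upd x j r $ i) = r * (\<Prod>i\<in>J - {j}. x $ i)" for r
        by (subst prod.remove[OF _ True]) (auto simp: upd_def intro!: prod.cong)
      then show ?thesis
        by (simp add: algebra_simps)
    next
      case False
      then have "(\<Prod>i\<in>J. upd x j r $ i) = (\<Prod>i\<in>J. x $ i)" for r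
        by (intro prod.cong) (auto simp: upd_def)
      then show ?thesis
        by (simp add: algebra_simps)
    qed
    have "(\<Sum>J | card J = i. \<Prod>k\<in>J. upd x j ((1 - t) * s + t * s') $ k) =
        (1 - t) * (\<Sum>J | card J = i. \<Prod>k\<in>J. upd x j s $ k) +
        t * (\<Sum>J | card J = i. \<Prod>k\<in>J. upd x j s' $ k)" for i
      by (simp add: prods sum.distrib sum_distrib_left)
    then show ?thesis
      by (simp add: sym_multilin_def distrib_left sum.distrib sum_distrib_left mult.left_commute)
  qed
  \<comment> \<open>Induction on a set containing the coordinates that are strictly between \<open>l\<close> and \<open>u\<close>:
    such a coordinate is a convex combination of \<open>l\<close> and \<open>u\<close>, and so is the graph point.\<close>
  have lifted: "(x, sym_multilin c x) \<in> convex hull ?W"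
    if "x \<in> box_X l u" "{j. x $ j \<noteq> l \<and> x $ j \<noteq> u} \<subseteq> A" for A and x :: "real ^ 'n::{finite,linorder}"
    using finite[of A] that
  proof (induction A arbitrary: x rule: finite_induct)
    case empty
    then have "x = box_vertex l u {j. x $ j = u}"
      by (auto simp: vec_eq_iff)
    then show ?case
      by (metis (mono_tags, lifting) hull_inc rangeI)
  next
    case (insert j A)
    define t where "t = (x $ j - l) / (u - l)"
    have box: "l \<le> x $ i" "x $ i \<le> u" for i
      using insert.prems by (auto simp: box_X_def)
    have "t * (u - l) = x $ j - l"
      using lu by (simp add: t_def)
    then have "x $ j = (1 - t) * l + t * u"
      by (simp add: algebra_simps)
    moreover have "0 \<le> t" "t \<le> 1"
      using lu box[of j] by (simp_all add: t_def)
    ultimately have t: "0 \<le> t" "t \<le> 1" "x $ j = (1 - t) * l + t * u"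
      by simp_all
    have end_in: "(upd x j s, sym_multilin c (upd x j s)) \<in> convex hull ?W" if "s \<in> {l, u}" for s
      using lu box insert.prems that
      by (intro insert.IH) (auto simp: box_X_def upd_def)
    have "x = upd x j ((1 - t) * l + t * u)"
      using t by (simp add: vec_eq_iff upd_def)
    then have "sym_multilin c x =
        (1 - t) * sym_multilin c (upd x j l) + t * sym_multilin c (upd x j u)"
      by (metis affine)
    moreover have "x = (1 - t) *\<^sub>R upd x j l + t *\<^sub>R upd x j u"
      using t by (auto simp: vec_eq_iff upd_def algebra_simps)
    ultimately have "(x, sym_multilin c x) =
        (1 - t) *\<^sub>R (upd x j l, sym_multilin c (upd x j l)) +
        t *\<^sub>R (upd x j u, sym_multilin c (upd x j u))"
      by simp
    then show ?case
      using t convexD_alt[OF convex_convex_hull end_in[of l] end_in[of u], of t] by simp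
  qed
  have "graph_G c l u \<subseteq> convex hull ?W"
    using lifted by (auto simp: graph_G_def)
  then show "convex hull (graph_G c l u) \<subseteq> convex hull ?W"
    by (simp add: hull_minimal)
  have "?W \<subseteq> graph_G c l u"
    using lu by (auto simp: graph_G_def box_X_def)
  then show "convex hull ?W \<subseteq> convex hull (graph_G c l u)"
    by (rule hull_mono)
qed

text \<open>
  On the diagonal \<open>x = (s, \<dots>, s)\<close> the polynomial takes the value
  \<open>\<Sum>i = 2..n. c i * (n choose i) * s ^ i\<close>, which has degree at least \<open>2\<close> in \<open>s\<close>.
  A hyperplane containing the graph would force it to agree with an affine function of \<open>s\<close>
  on an interval, unless the hyperplane is vertical; but the box lies in no proper hyperplane.
\<close>

lemma aff_dim_convex_hull_graph_G:
  fixes c :: "nat \<Rightarrow> real"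
  assumes lu: "l < u" and c: "\<exists>i \<in> {2..CARD('n::{finite,linorder})}. c i \<noteq> 0"
  shows "aff_dim (convex hull (graph_G c l u :: ((real ^ 'n::{finite,linorder}) \<times> real) set)) = CARD('n) + 1"
proof -
  let ?G = "graph_G c l u :: ((real ^ 'n::{finite,linorder}) \<times> real) set"
  have "p = 0" if "?G \<subseteq> {x. p \<bullet> x = d}" for p d
  proof -
    obtain a g where p: "p = (a, g)"
      by (cases p)
    have hyp: "a \<bullet> x + g * sym_multilin c x = d" if "x \<in> box_X l u" for x
      using that \<open>?G \<subseteq> _\<close> by (auto simp: p graph_G_def)
    have g: "g = 0"
    proof (rule ccontr)
      assume "g \<noteq> 0"
      \<comment> \<open>The coefficients of the equation of the hyperplane, restricted to the diagonal.\<close>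
      define e where "e i = (if i = 0 then - d else if i = 1 then \<Sum>j\<in>UNIV. a $ j
        else g * (c i * real (CARD('n) choose i)))" for i
      have "(\<Sum>i\<le>CARD('n). e i * s ^ i) = 0" if s: "s \<in> {l..u}" for s
      proof -
        have n2: "CARD('n) \<ge> 2"
          using c by auto
        then have split: "{..CARD('n)} = insert 0 (insert 1 {2..CARD('n)})"
          by auto
        have "sym_multilin c (vec s :: real ^ 'n::{finite,linorder}) =
            (\<Sum>i = 2..CARD('n). c i * (real (CARD('n) choose i) * s ^ i))"
          using n_subsets[of "UNIV :: 'n set"] by (simp add: sym_multilin_def)
        moreover have "(\<Sum>i\<le>CARD('n). e i * s ^ i) = - d + (\<Sum>j\<in>UNIV. a $ j) * s +
            g * (\<Sum>i = 2..CARD('n). c i * (real (CARD('n) choose i) * s ^ i))"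
          unfolding split by (simp add: e_def sum_distrib_left mult.assoc)
        moreover have "a \<bullet> vec s = (\<Sum>j\<in>UNIV. a $ j) * s"
          by (simp add: inner_vec_def sum_distrib_right)
        ultimately show ?thesis
          using hyp[of "vec s"] s by (simp add: box_X_def)
      qed
      then have "{l..u} \<subseteq> {s. (\<Sum>i\<le>CARD('n). e i * s ^ i) = 0}"
        by blast
      then have "infinite {s. (\<Sum>i\<le>CARD('n). e i * s ^ i) = 0}"
        using lu infinite_Icc finite_subset by blast
      then have "\<forall>i \<le> CARD('n). e i = 0"
        using polyfun_rootbound by blast
      moreover obtain i where "2 \<le> i" "i \<le> CARD('n)" "c i \<noteq> 0"
        using c by auto
      ultimately show False
        using \<open>g \<noteq> 0\<close> by (force simp: e_def)
    qed
    have "a $ j = 0" for j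
    proof -
      have "a \<bullet> (box_vertex l u {} + (u - l) *\<^sub>R axis j 1) = d"
        using hyp[of "box_vertex l u {} + (u - l) *\<^sub>R axis j 1"] g lu
        by (auto simp: box_X_def axis_def)
      moreover have "a \<bullet> box_vertex l u {} = d"
        using hyp[of "box_vertex l u {}"] g lu by (auto simp: box_X_def)
      ultimately show ?thesis
        using lu by (simp add: inner_add_right inner_axis)
    qed
    then show ?thesis
      by (simp add: p g vec_eq_iff zero_prod_def)
  qed
  then have "aff_dim ?G = DIM((real ^ 'n::{finite,linorder}) \<times> real)"
    using aff_dim_eq_DIM_iff[of ?G] by blast
  then show ?thesis
    by (simp add: aff_dim_convex_hull)
qed

section \<open>Facets and tight vertices\<close>

lemma ineq_lhs_eq_inner: "ineq_lhs b\<^sub>0 b b' p = b\<^sub>0 + (b, b') \<bullet> p"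
  by (cases p) (simp add: ineq_lhs_def inner_vec_def)

text \<open>
  On the hyperplane, \<open>y\<close> is an affine function of \<open>x\<close>, so the projection to the
  \<open>x\<close>-space has an affine inverse there.
\<close>

lemma aff_dim_projection_hyperplane:
  fixes P :: "((real ^ 'n::{finite,linorder}) \<times> real) set"
  assumes "b' \<noteq> 0" and P: "\<And>p. p \<in> P \<Longrightarrow> ineq_lhs b\<^sub>0 b b' p = 0"
  shows "aff_dim (fst ` P) = aff_dim P"
proof (rule antisym)
  show "aff_dim (fst ` P) \<le> aff_dim P"
    by (intro aff_dim_linear_image_le linear_fst)
  define f where "f x = (x, - (b \<bullet> x) / b')" for x :: "real ^ 'n::{finite,linorder}"
  have "linear f"
    unfolding f_def by (intro linearI) (auto simp: inner_add_right add_divide_distrib diff_divide_distrib)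
  have "(0, - b\<^sub>0 / b') + f (fst p) = p" if "p \<in> P" for p
    using P[OF that] \<open>b' \<noteq> 0\<close> by (cases p) (simp add: ineq_lhs_eq_inner f_def field_simps)
  then have "(+) (0, - b\<^sub>0 / b') ` f ` fst ` P = P"
    by (simp add: image_image)
  then have "aff_dim P = aff_dim (f ` fst ` P)"
    by (metis aff_dim_translation_eq)
  then show "aff_dim P \<le> aff_dim (fst ` P)"
    by (simp add: aff_dim_linear_image_le \<open>linear f\<close>)
qed

text \<open>
  A face of the convex hull of finitely many points is the convex hull of those of the points
  that lie in it.  So the dimension of the face is read off from the tight lifted vertices, and
  by the projection lemma from the tight vertices themselves; it has to be one less than the
  full dimension \<open>n + 1\<close>.
\<close>

lemma core_facet_iff_tight_vertices:
  fixes c :: "nat \<Rightarrow> real" and b :: "real ^ 'n::{finite,linorder}"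
  assumes lu: "l < u" and c: "\<exists>i \<in> {2..CARD('n)}. c i \<noteq> 0"
    and valid: "valid_core_ineq c l u b\<^sub>0 b b'"
  shows "core_facet c l u b\<^sub>0 b b' \<longleftrightarrow>
    aff_dim (box_vertex l u ` {K. exact_at c b\<^sub>0 b b' (box_vertex l u K)}) = CARD('n)"
proof -
  let ?G = "graph_G c l u :: ((real ^ 'n::{finite,linorder}) \<times> real) set"
  let ?T = "{p \<in> convex hull ?G. ineq_lhs b\<^sub>0 b b' p = 0}"
  let ?lift = "\<lambda>K. (box_vertex l u K :: real ^ 'n::{finite,linorder}, sym_multilin c (box_vertex l u K))"
  let ?Z = "{K. exact_at c b\<^sub>0 b b' (box_vertex l u K)}"
  have T_Int: "?T = convex hull ?G \<inter> {p. (b, b') \<bullet> p = - b\<^sub>0}"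
    by (auto simp: ineq_lhs_eq_inner)
  have face: "?T face_of convex hull ?G"
    unfolding T_Int
  proof (rule face_of_Int_supporting_hyperplane_ge)
    show "(b, b') \<bullet> p \<ge> - b\<^sub>0" if "p \<in> convex hull ?G" for p
      using valid that by (force simp: valid_core_ineq_def ineq_lhs_eq_inner)
  qed simp
  have T_hull: "?T = convex hull (?lift ` ?Z)"
  proof (rule antisym)
    have "compact (range ?lift)"
      by (simp add: finite_imp_compact)
    moreover have "?T face_of convex hull (range ?lift)"
      using face convex_hull_graph_G[OF lu, of c, where 'n = 'n] by simp
    ultimately obtain W where W: "W \<subseteq> range ?lift" "?T = convex hull W"
      by (rule face_of_convex_hull_subset)
    then have "W \<subseteq> ?T"
      by (metis hull_subset)
    then have "W \<subseteq> ?lift ` ?Z"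
      using W(1) by (fastforce simp: exact_at_def)
    then show "?T \<subseteq> convex hull (?lift ` ?Z)"
      unfolding W(2) by (rule hull_mono)
    have "convex ?T"
      using face by (rule face_of_imp_convex)
    moreover have "?lift ` ?Z \<subseteq> ?T"
      using lu by (auto simp: exact_at_def graph_G_def box_X_def intro!: hull_inc)
    ultimately show "convex hull (?lift ` ?Z) \<subseteq> ?T"
      by (simp add: hull_minimal)
  qed
  have "b' \<noteq> 0"
    using valid by (auto simp: valid_core_ineq_def core_ineq_def)
  then have "aff_dim (fst ` ?lift ` ?Z) = aff_dim (?lift ` ?Z)"
    by (rule aff_dim_projection_hyperplane) (auto simp: exact_at_def)
  also have "fst ` ?lift ` ?Z = box_vertex l u ` ?Z"
    by (simp add: image_image)
  finally have dim_T: "aff_dim ?T = aff_dim (box_vertex l u ` ?Z)"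
    unfolding T_hull by (simp add: aff_dim_convex_hull)
  have "?T \<noteq> {}" if "aff_dim ?T = CARD('n)"
    using that by (metis aff_dim_empty_eq of_nat_0_le_iff not_one_le_zero neg_0_le_iff_le)
  then have "core_facet c l u b\<^sub>0 b b' \<longleftrightarrow> aff_dim ?T = CARD('n)"
    unfolding core_facet_def facet_of_def
    using valid face aff_dim_convex_hull_graph_G[OF lu c] by auto
  then show ?thesis
    using dim_T by simp
qed

section \<open>Inequalities with equal coefficients\<close>

lemma sym_multilin_permute:
  fixes x :: "real ^ 'n::{finite,linorder}" and f :: "'n \<Rightarrow> 'n"
  assumes "bij f"
  shows "sym_multilin c (\<chi> j. x $ f j) = sym_multilin c x"
proof -
  have inj: "inj_on f J" for J
    using assms by (meson bij_is_inj inj_on_subset subset_UNIV)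
  have "(\<Sum>J | card J = i. \<Prod>j\<in>J. x $ f j) = (\<Sum>J | card J = i. \<Prod>j\<in>J. x $ j)" for i
  proof (rule sum.reindex_bij_witness[of _ "\<lambda>J. f -` J" "\<lambda>J. f ` J"])
    show "(\<Prod>j\<in>f ` J. x $ j) = (\<Prod>j\<in>J. x $ f j)" for J
      by (simp add: prod.reindex[OF inj])
    show "f -` f ` J = J" for J
      using assms by (simp add: bij_is_inj inj_vimage_image_eq)
    show "f ` f -` J = J" for J
      using assms by (simp add: bij_is_surj surj_image_vimage_eq)
    show "f ` J \<in> {J. card J = i}" if "J \<in> {J. card J = i}" for J
      using that by (simp add: card_image[OF inj])
    show "f -` J \<in> {J. card J = i}" if "J \<in> {J. card J = i}" for J
      using that assms by (simp add: card_vimage_inj bij_is_inj bij_is_surj)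
  qed
  then show ?thesis
    by (simp add: sym_multilin_def)
qed

text \<open>
  A permutation of the coordinates carries any vertex to any other one of the same layer, and it
  preserves both the coordinate sum and the symmetric polynomial.
\<close>

lemma exact_at_box_vertex_cong_card:
  fixes b :: "real ^ 'n::{finite,linorder}"
  assumes b_const: "\<forall>i j. b $ i = b $ j" and card: "card K = card K'"
  shows "exact_at c b\<^sub>0 b b' (box_vertex l u K) \<longleftrightarrow> exact_at c b\<^sub>0 b b' (box_vertex l u K')"
proof -
  have "card (- K) = card (- K')"
    using card by (simp add: Compl_eq_Diff_UNIV card_Diff_subset)
  then obtain f g where fg: "bij_betw f K K'" "bij_betw g (- K) (- K')"
    using card by (meson finite finite_same_card_bij)
  define h where "h j = (if j \<in> K then f j else g j)" for j
  have "bij h"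
    using bij_betw_disjoint_Un[OF fg] by (simp add: h_def[abs_def] Compl_partition)
  have "h j \<in> K' \<longleftrightarrow> j \<in> K" for j
    using bij_betwE[OF fg(1)] bij_betwE[OF fg(2)] by (auto simp: h_def)
  then have v: "box_vertex l u K = (\<chi> j. (box_vertex l u K' :: real ^ 'n::{finite,linorder}) $ h j)"
    by (simp add: vec_eq_iff)
  obtain s where s: "\<And>j. b $ j = s"
    using b_const by metis
  have "(\<Sum>j\<in>UNIV. b $ j * (box_vertex l u K :: real ^ 'n::{finite,linorder}) $ j) =
      (\<Sum>j\<in>UNIV. b $ j * (box_vertex l u K' :: real ^ 'n::{finite,linorder}) $ j)"
    using card by (simp only: s flip: sum_distrib_left) (simp only: sum_box_vertex)
  moreover have "sym_multilin c (box_vertex l u K :: real ^ 'n::{finite,linorder}) = sym_multilin c (box_vertex l u K')"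
    unfolding v by (rule sym_multilin_permute[OF \<open>bij h\<close>])
  ultimately show ?thesis
    by (simp only: exact_at_def ineq_lhs_def fst_conv snd_conv)
qed

theorem proposition3p2:
  fixes c :: "nat \<Rightarrow> real" and l u b\<^sub>0 b' :: real and b :: "real ^ 'n::{finite,linorder}"
  assumes n_ge_2: "CARD('n) \<ge> 2"
    and l_less_u: "l < u"
    and c_nonzero: "\<exists>i \<in> {2..CARD('n)}. c i \<noteq> 0"
    and valid: "valid_core_ineq c l u b\<^sub>0 b b'"
    and b_const: "\<forall>i j. b $ i = b $ j"
  shows "core_facet c l u b\<^sub>0 b b' \<longleftrightarrow>
    (\<exists>k \<in> {0..CARD('n)}. \<exists>k' \<in> {0..CARD('n)}. k \<noteq> k' \<and> k \<notin> {0, CARD('n)} \<and>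
       exact_at c b\<^sub>0 b b' (simplex_pt l u k) \<and> exact_at c b\<^sub>0 b b' (simplex_pt l u k'))"
proof -
  define R where "R = {k. exact_at c b\<^sub>0 b b' (simplex_pt l u k)}"
  have "exact_at c b\<^sub>0 b b' (box_vertex l u K) \<longleftrightarrow> card K \<in> R" for K
  proof -
    have "card K = card {j :: 'n. card {..j} \<le> card K}"
      by (simp add: card_initial_segment card_mono)
    then show ?thesis
      unfolding R_def mem_Collect_eq simplex_pt_eq_box_vertex
      by (rule exact_at_box_vertex_cong_card[OF b_const])
  qed
  then have "{K. exact_at c b\<^sub>0 b b' (box_vertex l u K)} = {K. card K \<in> R}"
    by blast
  then show ?thesis
    using core_facet_iff_tight_vertices[OF l_less_u c_nonzero valid]
      aff_dim_layers[OF n_ge_2 l_less_u, of R]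
    by (simp add: R_def)
qed

end
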